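(* For every even $n\ge 4$, every triangle switch chain on $\mathcal{G}_n$ is irreducible.
   Context: $\mathcal{G}_n$ is the set of simple 3-regular graphs on vertex set $[n]=\{1,\dots,n\}$. A make move ${\tt make}(yxvwz)$ applies to a graph $G=(V,E)$ when $y,x,v,w,z$ are distinct vertices, $yxvwz$ is a path in $G$ (i.e. $yx,xv,vw,wz\in E$), and $xw\notin E$, $yz\notin E$; it replaces $E$ by $(E\setminus\{xy,wz\})\cup\{xw,yz\}$, creating the triangle $vxwv$. A break move ${\tt break}(vxw,yz)$ applies when $vxwv$ is a triangle of $G$, $yz\in E$ with $\{y,z\}\cap\{v,x,w\}=\emptyset$, and $xy\notin E$, $wz\notin E$; it replaces $E$ by $(E\setminus\{xw,yz\})\cup\{xy,wz\}$. Both moves map $\mathcal{G}_n$ to $\mathcal{G}_n$; a triangle switch is a make or break move. A Markov chain on $\mathcal{G}_n$ is a triangle switch chain if its transition matrix $P$ satisfies $P(G,G')>0$ whenever $G'$ is obtained from $G$ by a single triangle switch. *)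

theory Defs
  imports Complex_Main
begin

text \<open>A simple graph on the fixed vertex set \<open>{1..n}\<close> is identified with its edge set,
  a set of two-element subsets of \<open>{1..n}\<close>.\<close>

type_synonym graph = "nat set set"

definition simple_graphs :: "nat \<Rightarrow> graph set" where
  "simple_graphs n = {E. \<forall>e\<in>E. e \<subseteq> {1..n} \<and> card e = 2}"

definition degree :: "graph \<Rightarrow> nat \<Rightarrow> nat" where
  "degree E v = card {e \<in> E. v \<in> e}"

definition cubic_graphs :: "nat \<Rightarrow> graph set" where
  "cubic_graphs n = {E \<in> simple_graphs n. \<forall>v\<in>{1..n}. degree E v = 3}"

lemma finite_cubic_graphs: "finite (cubic_graphs n)"
proof (rule finite_subset)
  show "cubic_graphs n \<subseteq> Pow (Pow {1..n})"
    by (auto simp: cubic_graphs_def simple_graphs_def)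
qed simp

definition make_applicable :: "graph \<Rightarrow> nat \<Rightarrow> nat \<Rightarrow> nat \<Rightarrow> nat \<Rightarrow> nat \<Rightarrow> bool" where
  "make_applicable E y x v w z \<longleftrightarrow>
     distinct [y, x, v, w, z] \<and>
     {y, x} \<in> E \<and> {x, v} \<in> E \<and> {v, w} \<in> E \<and> {w, z} \<in> E \<and>
     {x, w} \<notin> E \<and> {y, z} \<notin> E"

text \<open>The outcome of a make move does not mention the middle vertex of the path.\<close>

definition make :: "graph \<Rightarrow> nat \<Rightarrow> nat \<Rightarrow> nat \<Rightarrow> nat \<Rightarrow> graph" where
  "make E y x w z = (E - {{x, y}, {w, z}}) \<union> {{x, w}, {y, z}}"

definition break_applicable :: "graph \<Rightarrow> nat \<Rightarrow> nat \<Rightarrow> nat \<Rightarrow> nat \<Rightarrow> nat \<Rightarrow> bool" where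
  "break_applicable E v x w y z \<longleftrightarrow>
     distinct [v, x, w] \<and>
     {v, x} \<in> E \<and> {x, w} \<in> E \<and> {w, v} \<in> E \<and>
     {y, z} \<in> E \<and> {y, z} \<inter> {v, x, w} = {} \<and>
     {x, y} \<notin> E \<and> {w, z} \<notin> E"

text \<open>Likewise, the third vertex of the destroyed triangle does not occur in the outcome of a
  break move.\<close>

definition break :: "graph \<Rightarrow> nat \<Rightarrow> nat \<Rightarrow> nat \<Rightarrow> nat \<Rightarrow> graph" where
  "break E x w y z = (E - {{x, w}, {y, z}}) \<union> {{x, y}, {w, z}}"

definition triangle_switch :: "graph \<Rightarrow> graph \<Rightarrow> bool" where
  "triangle_switch E E' \<longleftrightarrow>
     (\<exists>y x v w z. make_applicable E y x v w z \<and> E' = make E y x w z) \<or>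
     (\<exists>v x w y z. break_applicable E v x w y z \<and> E' = break E x w y z)"

text \<open>A time-homogeneous Markov chain on a finite state space \<open>S\<close> is given by its transition
  matrix; entries of \<open>P\<close> outside \<open>S\<close> are irrelevant.  The sums below are meaningful for
  finite \<open>S\<close> only.\<close>

definition transition_matrix_on :: "'a set \<Rightarrow> ('a \<Rightarrow> 'a \<Rightarrow> real) \<Rightarrow> bool" where
  "transition_matrix_on S P \<longleftrightarrow>
     (\<forall>x\<in>S. \<forall>y\<in>S. 0 \<le> P x y) \<and> (\<forall>x\<in>S. (\<Sum>y\<in>S. P x y) = 1)"

fun step_prob :: "'a set \<Rightarrow> ('a \<Rightarrow> 'a \<Rightarrow> real) \<Rightarrow> nat \<Rightarrow> 'a \<Rightarrow> 'a \<Rightarrow> real" where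
  "step_prob S P 0 x y = (if x = y then 1 else 0)"
| "step_prob S P (Suc t) x y = (\<Sum>u\<in>S. P x u * step_prob S P t u y)"

text \<open>Requiring at least one step also on the diagonal is the stronger of the two usual
  conventions; for a transition matrix on a finite state space they agree.\<close>

definition irreducible_on :: "'a set \<Rightarrow> ('a \<Rightarrow> 'a \<Rightarrow> real) \<Rightarrow> bool" where
  "irreducible_on S P \<longleftrightarrow> (\<forall>x\<in>S. \<forall>y\<in>S. \<exists>t\<ge>1. step_prob S P t x y > 0)"

text \<open>Further positive entries, besides those of the triangle switches, are allowed.\<close>

definition triangle_switch_chain :: "nat \<Rightarrow> (graph \<Rightarrow> graph \<Rightarrow> real) \<Rightarrow> bool" where
  "triangle_switch_chain n P \<longleftrightarrow>
     transition_matrix_on (cubic_graphs n) P \<and>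
     (\<forall>G\<in>cubic_graphs n. \<forall>G'\<in>cubic_graphs n. triangle_switch G G' \<longrightarrow> P G G' > 0)"

end

theory Submission
  imports Defs
begin

text \<open>
  Triangle switches are reversible, so it suffices to bring any two cubic graphs on a vertex set
  \<open>V\<close> to a common form; this goes by induction on \<open>|V|\<close>.  Unless \<open>|V| = 6\<close>, every cubic graph can
  be given a component $K_4$: a triangle-free graph admits a make move, a triangle can be extended
  to a diamond ($K_4$ minus an edge), and a diamond can be closed to a $K_4$.  A $K_4$ can exchange
  one of its vertices for any outside vertex by two break moves followed by two make moves, so in
  both graphs it can be moved to the same four vertices and split off.  For \<open>|V| = 6\<close> there are only
  the prism and $K_{3,3}$; one break move turns the prism into $K_{3,3}$, and a make followed by a break
  transposes two vertices of $K_{3,3}$.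
\<close>

section \<open>Cubic graphs on an arbitrary vertex set and their neighbourhoods\<close>

definition nbs :: "graph \<Rightarrow> nat \<Rightarrow> nat set" where
  "nbs E v = {u. {v, u} \<in> E}"

text \<open>The vertex set is a parameter because the induction in \<open>reach_cubic\<close>
  removes four vertices at a time. A neighbourhood of cardinality 3 is in particular finite.\<close>

definition cubic_on :: "nat set \<Rightarrow> graph \<Rightarrow> bool" where
  "cubic_on V E \<longleftrightarrow> (\<forall>e\<in>E. e \<subseteq> V \<and> card e = 2) \<and> (\<forall>v\<in>V. card (nbs E v) = 3)"

abbreviation reach :: "graph \<Rightarrow> graph \<Rightarrow> bool" where
  "reach \<equiv> triangle_switch\<^sup>*\<^sup>*"

lemma degree_eq_card_nbs:
  assumes "\<forall>e\<in>E. card e = 2"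
  shows "degree E v = card (nbs E v)"
proof -
  have "bij_betw (\<lambda>u. {v, u}) (nbs E v) {e \<in> E. v \<in> e}"
    unfolding bij_betw_def
  proof
    show "inj_on (\<lambda>u. {v, u}) (nbs E v)"
      by (auto simp: inj_on_def doubleton_eq_iff)
    show "(\<lambda>u. {v, u}) ` nbs E v = {e \<in> E. v \<in> e}"
    proof
      show "{e \<in> E. v \<in> e} \<subseteq> (\<lambda>u. {v, u}) ` nbs E v"
      proof
        fix e assume e: "e \<in> {e \<in> E. v \<in> e}"
        then obtain x y where "e = {x, y}" using assms by (auto simp: card_2_iff)
        then show "e \<in> (\<lambda>u. {v, u}) ` nbs E v"
          using e by (auto simp: nbs_def image_iff insert_commute)
      qed
    qed (auto simp: nbs_def)
  qed
  then show ?thesis unfolding degree_def by (simp add: bij_betw_same_card)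
qed

lemma cubic_graphs_iff: "E \<in> cubic_graphs n \<longleftrightarrow> cubic_on {1..n} E"
  unfolding cubic_graphs_def simple_graphs_def cubic_on_def
  by (auto simp: degree_eq_card_nbs)

lemma cubic_edge:
  assumes "cubic_on V E" "{u, v} \<in> E"
  shows "u \<in> V" "v \<in> V" "u \<noteq> v"
  using assms unfolding cubic_on_def by fastforce+

lemma cubic_edge_cases:
  assumes "cubic_on V E" "e \<in> E"
  obtains u v where "e = {u, v}" "u \<noteq> v" "u \<in> V" "v \<in> V"
proof -
  have "card e = 2" "e \<subseteq> V" using assms unfolding cubic_on_def by auto
  then show ?thesis using that by (auto simp: card_2_iff)
qed

text \<open>Both orders of the pair are listed so that the two equivalences, used as rewrite rules,
  decide every edge literal at \<open>v\<close>. The variants \<open>cubic_nbs1\<close> to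
  \<open>cubic_nbs3\<close> start from one to three known neighbours.\<close>

lemma cubic_nbs:
  assumes "cubic_on V E" "v \<in> V"
  obtains a b c where "distinct [v, a, b, c]"
    "\<And>u. {v, u} \<in> E \<longleftrightarrow> u = a \<or> u = b \<or> u = c"
    "\<And>u. {u, v} \<in> E \<longleftrightarrow> u = a \<or> u = b \<or> u = c"
proof -
  have "card (nbs E v) = 3" using assms unfolding cubic_on_def by auto
  then obtain a b c where *: "nbs E v = {a, b, c}" "a \<noteq> b" "a \<noteq> c" "b \<noteq> c"
    by (auto simp: card_3_iff)
  then have "{v, u} \<in> E \<longleftrightarrow> u = a \<or> u = b \<or> u = c" for u
    unfolding nbs_def by blast
  then show ?thesis
    using that[of a b c] * cubic_edge[OF assms(1), of v] by (auto simp: insert_commute)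
qed

lemma cubic_nbs1:
  assumes "cubic_on V E" "{v, a} \<in> E"
  obtains b c where "distinct [v, a, b, c]"
    "\<And>u. {v, u} \<in> E \<longleftrightarrow> u = a \<or> u = b \<or> u = c"
    "\<And>u. {u, v} \<in> E \<longleftrightarrow> u = a \<or> u = b \<or> u = c"
proof -
  have "v \<in> V" using cubic_edge[OF assms] by auto
  from cubic_nbs[OF assms(1) this] obtain x y z where
    *: "distinct [v, x, y, z]" "\<And>u. {v, u} \<in> E \<longleftrightarrow> u = x \<or> u = y \<or> u = z"
    "\<And>u. {u, v} \<in> E \<longleftrightarrow> u = x \<or> u = y \<or> u = z" by blast
  then consider "a = x" | "a = y" | "a = z" using assms(2) *(2)[of a] by blast
  then show ?thesis
  proof cases
    case 1 show ?thesis by (rule that[of y z]) (use * 1 in auto)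
  next
    case 2 show ?thesis by (rule that[of x z]) (use * 2 in auto)
  next
    case 3 show ?thesis by (rule that[of x y]) (use * 3 in auto)
  qed
qed

lemma cubic_other_nb:
  assumes "cubic_on V E" "{v, a} \<in> E"
  obtains b where "{v, b} \<in> E" "b \<noteq> a" "b \<noteq> v"
  by (rule cubic_nbs1[OF assms]) (rule that, auto)

lemma cubic_nbs2:
  assumes "cubic_on V E" "{v, a} \<in> E" "{v, b} \<in> E" "a \<noteq> b"
  obtains c where "distinct [v, a, b, c]"
    "\<And>u. {v, u} \<in> E \<longleftrightarrow> u = a \<or> u = b \<or> u = c"
    "\<And>u. {u, v} \<in> E \<longleftrightarrow> u = a \<or> u = b \<or> u = c"
proof -
  from cubic_nbs1[OF assms(1,2)] obtain y z where
    *: "distinct [v, a, y, z]" "\<And>u. {v, u} \<in> E \<longleftrightarrow> u = a \<or> u = y \<or> u = z"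
    "\<And>u. {u, v} \<in> E \<longleftrightarrow> u = a \<or> u = y \<or> u = z" by blast
  then consider "b = y" | "b = z" using assms(3,4) *(2)[of b] by blast
  then show ?thesis
  proof cases
    case 1 show ?thesis by (rule that[of z]) (use * 1 in auto)
  next
    case 2 show ?thesis by (rule that[of y]) (use * 2 in auto)
  qed
qed

lemma cubic_nbs3:
  assumes "cubic_on V E" "{v, a} \<in> E" "{v, b} \<in> E" "{v, c} \<in> E" "distinct [a, b, c]"
  shows "{v, u} \<in> E \<longleftrightarrow> u = a \<or> u = b \<or> u = c"
    "{u, v} \<in> E \<longleftrightarrow> u = a \<or> u = b \<or> u = c"
proof -
  have "a \<noteq> b" using assms(5) by auto
  obtain d where "distinct [v, a, b, d]" and *: "\<And>u. {v, u} \<in> E \<longleftrightarrow> u = a \<or> u = b \<or> u = d"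
    by (rule cubic_nbs2[OF assms(1,2,3) \<open>a \<noteq> b\<close>]) (rule that)
  then have "d = c" using assms by auto
  with * show "{v, u} \<in> E \<longleftrightarrow> u = a \<or> u = b \<or> u = c" by auto
  then show "{u, v} \<in> E \<longleftrightarrow> u = a \<or> u = b \<or> u = c"  by (simp add: insert_commute)
qed

section \<open>Switches preserve cubic graphs and are reversible\<close>

lemma break_in_iff:
  "{s, t} \<in> break E x w y z \<longleftrightarrow>
    ({s, t} \<in> E \<and> {s, t} \<noteq> {x, w} \<and> {s, t} \<noteq> {y, z}) \<or> {s, t} = {x, y} \<or> {s, t} = {w, z}"
  by (auto simp: break_def)

lemma make_in_iff:
  "{s, t} \<in> make E y x w z \<longleftrightarrow>
    ({s, t} \<in> E \<and> {s, t} \<noteq> {x, y} \<and> {s, t} \<noteq> {w, z}) \<or> {s, t} = {x, w} \<or> {s, t} = {y, z}"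
  by (auto simp: make_def)

lemmas move_iffs = break_in_iff make_in_iff doubleton_eq_iff

text \<open>Apart from their applicability conditions both moves are the same exchange of two edges,
  so degrees have to be counted only once, for \<open>break\<close>.\<close>

lemma make_eq_break: "make E y x w z = break E x y w z"
  by (simp add: make_def break_def)

text \<open>Each of the four vertices trades one neighbour for a new one. Stated for an arbitrary
  exchange of two edges, so that it covers make moves through \<open>make_eq_break\<close>.\<close>

lemma cubic_on_break:
  assumes c: "cubic_on V E" and d: "distinct [x, w, y, z]"
    and "{x, w} \<in> E" "{y, z} \<in> E" "{x, y} \<notin> E" "{w, z} \<notin> E"
  shows "cubic_on V (break E x w y z)"
proof -
  let ?E = "break E x w y z"
  have V: "x \<in> V" "w \<in> V" "y \<in> V" "z \<in> V" using cubic_edge[OF c] assms by blast+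
  have "e \<subseteq> V \<and> card e = 2" if "e \<in> ?E" for e
    using that c d V unfolding break_def cubic_on_def by auto
  moreover have "card (nbs ?E v) = 3" if v: "v \<in> V" for v
  proof -
    have fin: "finite (nbs E v)" and c3: "card (nbs E v) = 3"
      using c v unfolding cubic_on_def by (auto intro: card_ge_0_finite)
    have swap: "card (insert q (nbs E v - {p})) = 3" if "{v, p} \<in> E" "{v, q} \<notin> E" for p q
      using that fin c3 by (auto simp: nbs_def card_insert_if)
    have "nbs ?E x = insert y (nbs E x - {w})" "nbs ?E w = insert z (nbs E w - {x})"
      "nbs ?E y = insert x (nbs E y - {z})" "nbs ?E z = insert w (nbs E z - {y})"
      using d by (auto simp: nbs_def move_iffs)
    moreover have "nbs ?E v = nbs E v" if "v \<notin> {x, w, y, z}"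
      using that by (auto simp: nbs_def move_iffs)
    ultimately show ?thesis
      using swap[of w y] swap[of x z] swap[of z x] swap[of y w] c3 assms(3-)
      by (cases "v \<in> {x, w, y, z}") (auto simp: insert_commute)
  qed
  ultimately show ?thesis unfolding cubic_on_def by blast
qed

lemma make_sym:
  assumes "make_applicable E y x v w z"
  shows "break_applicable (make E y x w z) v x w y z \<and> break (make E y x w z) x w y z = E"
  using assms unfolding make_applicable_def break_applicable_def
  by (auto simp: move_iffs) (auto simp: make_def break_def insert_commute doubleton_eq_iff)

lemma break_sym:
  assumes "cubic_on V E" "break_applicable E v x w y z"
  shows "make_applicable (break E x w y z) y x v w z \<and> make (break E x w y z) y x w z = E"
proof -
  \<comment> \<open>This part of \<open>distinct\<close> in \<open>make_applicable\<close> comes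
    from the absence of loops in a cubic graph.\<close>
  have "y \<noteq> z" using cubic_edge[OF assms(1)] assms(2) unfolding break_applicable_def by auto
  then show ?thesis
    using assms(2) unfolding make_applicable_def break_applicable_def
    by (auto simp: move_iffs insert_commute) (auto simp: make_def break_def insert_commute doubleton_eq_iff)
qed

lemma triangle_switch_make: "make_applicable E y x v w z \<Longrightarrow> triangle_switch E (make E y x w z)"
  unfolding triangle_switch_def by blast

lemma triangle_switch_break: "break_applicable E v x w y z \<Longrightarrow> triangle_switch E (break E x w y z)"
  unfolding triangle_switch_def by blast

lemma switch_sym:
  assumes "cubic_on V E" "triangle_switch E E'"
  shows "triangle_switch E' E"
  using assms(2) unfolding triangle_switch_def[of E]
proof (elim disjE exE conjE)
  fix y x v w z assume "make_applicable E y x v w z" "E' = make E y x w z"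
  then show ?thesis using make_sym triangle_switch_break by metis
next
  fix y x v w z assume "break_applicable E v x w y z" "E' = break E x w y z"
  then show ?thesis using break_sym[OF assms(1)] triangle_switch_make by metis
qed

lemma cubic_on_switch:
  assumes "cubic_on V E" "triangle_switch E E'"
  shows "cubic_on V E'"
  using assms(2) unfolding triangle_switch_def
proof (elim disjE exE conjE)
  fix y x v w z assume "make_applicable E y x v w z" "E' = make E y x w z"
  then show ?thesis using cubic_on_break[OF assms(1), of x y w z]
    by (auto simp: make_eq_break make_applicable_def insert_commute)
next
  fix y x v w z assume *: "break_applicable E v x w y z" "E' = break E x w y z"
  have "y \<noteq> z" using cubic_edge[OF assms(1)] * unfolding break_applicable_def by auto
  then show ?thesis using cubic_on_break[OF assms(1), of x w y z] *
    by (auto simp: break_applicable_def)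
qed

lemma cubic_on_reach:
  assumes "reach E E'" "cubic_on V E"
  shows "cubic_on V E'"
  using assms by (induction rule: rtranclp_induct) (auto intro: cubic_on_switch)

lemma reach_sym:
  assumes "reach E E'" "cubic_on V E"
  shows "reach E' E"
  using assms
proof (induction rule: rtranclp_induct)
  case (step F G)
  then have "triangle_switch G F" using switch_sym cubic_on_reach by blast
  then show ?case using step by (meson converse_rtranclp_into_rtranclp)
qed simp

lemma make_step: "make_applicable E y x v w z \<Longrightarrow> reach E (make E y x w z)"
  by (rule r_into_rtranclp) (rule triangle_switch_make)

lemma break_step: "break_applicable E v x w y z \<Longrightarrow> reach E (break E x w y z)"
  by (rule r_into_rtranclp) (rule triangle_switch_break)

section \<open>Completing a diamond to a $K_4$\<close>

definition clique4 :: "graph \<Rightarrow> nat set \<Rightarrow> bool" where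
  "clique4 E A \<longleftrightarrow> card A = 4 \<and> (\<forall>u\<in>A. \<forall>v\<in>A. u \<noteq> v \<longrightarrow> {u, v} \<in> E)"

definition K4able :: "graph \<Rightarrow> bool" where
  "K4able E \<longleftrightarrow> (\<exists>E' A. reach E E' \<and> clique4 E' A)"

lemma K4able_reach: "reach E E' \<Longrightarrow> K4able E' \<Longrightarrow> K4able E"
  unfolding K4able_def by (meson rtranclp_trans)

lemma clique4I:
  assumes "distinct [a, b, c, d]"
    "{a, b} \<in> E" "{a, c} \<in> E" "{a, d} \<in> E" "{b, c} \<in> E" "{b, d} \<in> E" "{c, d} \<in> E"
  shows "clique4 E {a, b, c, d}"
  using assms by (auto simp: clique4_def insert_commute)

text \<open>\<open>a\<close> and \<open>b\<close> are the ends of the diamond, \<open>p\<close> and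
  \<open>q\<close> their third neighbours. The make move along \<open>p a c b q\<close> adds the
  missing edge \<open>{a, b}\<close>.\<close>

lemma K4able_diamond_ends:
  assumes "distinct [a, b, c, d, p, q]"
    "{a, c} \<in> E" "{a, d} \<in> E" "{b, c} \<in> E" "{b, d} \<in> E" "{c, d} \<in> E"
    "{a, b} \<notin> E" "{p, q} \<notin> E" "{a, p} \<in> E" "{b, q} \<in> E"
  shows "K4able E"
proof -
  have *: "make_applicable E p a c b q"
    using assms by (auto simp: make_applicable_def insert_commute)
  have "clique4 (make E p a b q) {a, b, c, d}"
    by (rule clique4I) (use assms in \<open>auto simp: move_iffs\<close>)
  then show ?thesis using make_step[OF *] unfolding K4able_def by blast
qed

text \<open>If the third neighbours \<open>p\<close>, \<open>q\<close> of the ends are distinct and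
  nonadjacent, \<open>K4able_diamond_ends\<close> applies at once. If they coincide or are adjacent,
  a break move using an edge farther away and then a make move produce another diamond to which it
  applies.\<close>

lemma K4able_diamond:
  assumes E: "cubic_on V E" and D: "distinct [a, b, c, d]"
    "{a, c} \<in> E" "{a, d} \<in> E" "{b, c} \<in> E" "{b, d} \<in> E" "{c, d} \<in> E"
  shows "K4able E"
proof (cases "{a, b} \<in> E")
  case True
  have "clique4 E {a, b, c, d}" by (rule clique4I) (use assms True in auto)
  then show ?thesis unfolding K4able_def by blast
next
  case False
  have pre: "{a, c} \<in> E" "{a, d} \<in> E" "c \<noteq> d"
    using D by (auto simp: insert_commute)
  obtain p where a: "distinct [a, c, d, p]" "\<And>u. {a, u} \<in> E \<longleftrightarrow> u = c \<or> u = d \<or> u = p"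
     "\<And>u. {u, a} \<in> E \<longleftrightarrow> u = c \<or> u = d \<or> u = p"
    by (rule cubic_nbs2[OF E pre]) (rule that)
  have pre: "{b, c} \<in> E" "{b, d} \<in> E" "c \<noteq> d"
    using D by (auto simp: insert_commute)
  obtain q where b: "distinct [b, c, d, q]" "\<And>u. {b, u} \<in> E \<longleftrightarrow> u = c \<or> u = d \<or> u = q"
     "\<And>u. {u, b} \<in> E \<longleftrightarrow> u = c \<or> u = d \<or> u = q"
    by (rule cubic_nbs2[OF E pre]) (rule that)
  have pre: "{c, a} \<in> E" "{c, b} \<in> E" "{c, d} \<in> E" "distinct [a, b, d]"
    using D by (auto simp: insert_commute)
  have c: "{c, u} \<in> E \<longleftrightarrow> u = a \<or> u = b \<or> u = d" "{u, c} \<in> E \<longleftrightarrow> u = a \<or> u = b \<or> u = d" for u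
    by (rule cubic_nbs3[OF E pre])+
  have pre: "{d, a} \<in> E" "{d, b} \<in> E" "{d, c} \<in> E" "distinct [a, b, c]"
    using D by (auto simp: insert_commute)
  have d: "{d, u} \<in> E \<longleftrightarrow> u = a \<or> u = b \<or> u = c" "{u, d} \<in> E \<longleftrightarrow> u = a \<or> u = b \<or> u = c" for u
    by (rule cubic_nbs3[OF E pre])+
  have pq: "distinct [a, b, c, d, p]" "distinct [a, b, c, d, q]"
    using a b c d D False by auto
  consider (far) "p \<noteq> q" "{p, q} \<notin> E" | (same) "p = q" | (adj) "p \<noteq> q" "{p, q} \<in> E" by blast
  then show ?thesis
  proof cases
    case far
    show ?thesis
      by (rule K4able_diamond_ends[of a b c d p q]) (use far D pq a b False in auto)
  next
    case same
    note same = same[symmetric]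
    have pre: "{p, a} \<in> E" "{p, b} \<in> E" "a \<noteq> b"
      using D(1) by (auto simp: a b same)
    obtain r where p: "distinct [p, a, b, r]" "\<And>u. {p, u} \<in> E \<longleftrightarrow> u = a \<or> u = b \<or> u = r"
      "\<And>u. {u, p} \<in> E \<longleftrightarrow> u = a \<or> u = b \<or> u = r"
      by (rule cubic_nbs2[OF E pre]) (rule that)
    have r: "distinct [a, b, c, d, p, r]" using p(1) pq p(2)[of r] c(2)[of p] d(2)[of p] by auto
    have pre: "{r, p} \<in> E"
      by (simp add: p insert_commute)
    obtain s where s: "{r, s} \<in> E" "s \<noteq> p" "s \<noteq> r"
      by (rule cubic_other_nb[OF E pre]) (rule that)
    have s': "distinct [a, b, c, d, p, r, s]" using r s a(3)[of r] b(3)[of r] c(2)[of r] d(2)[of r] by (auto simp: same)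
    have pre: "{s, r} \<in> E"
      by (simp add: s insert_commute)
    obtain t where t: "{s, t} \<in> E" "t \<noteq> r" "t \<noteq> s"
      by (rule cubic_other_nb[OF E pre]) (rule that)
    have t': "distinct [a, b, c, d, p, r, s, t]" using s' t a(3)[of s] b(3)[of s] c(2)[of s] d(2)[of s] p(3)[of s] by (auto simp: same)
    \<comment> \<open>After both moves the diamond has the ends \<open>c\<close>, \<open>p\<close>
      and the middle edge \<open>{b, d}\<close>. The third neighbours of its ends are
      \<open>t\<close> and \<open>a\<close>, nonadjacent because \<open>a\<close> is then joined to
      \<open>p\<close>, \<open>s\<close> and \<open>r\<close> only.\<close>
    let ?E1 = "break E a c s t"
    have 1: "break_applicable E d a c s t"
      using t' t by (auto simp: break_applicable_def a b c d)
    let ?E2 = "make ?E1 a d p r"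
    have 2: "make_applicable ?E1 a d b p r"
      using t' by (auto simp: make_applicable_def move_iffs a b c d p same)
    have "K4able ?E2"
      by (rule K4able_diamond_ends[of c p b d t a])
        (use t' in \<open>auto simp: move_iffs a b c d p same\<close>)
    then show ?thesis using break_step[OF 1] make_step[OF 2] K4able_reach by blast
  next
    case adj
    then have adj': "{q, p} \<in> E" by (simp add: insert_commute)
    have pre: "{p, a} \<in> E" "{p, q} \<in> E" "a \<noteq> q"
      using D(1) pq by (auto simp: a b adj adj')
    obtain p' where p: "distinct [p, a, q, p']" "\<And>u. {p, u} \<in> E \<longleftrightarrow> u = a \<or> u = q \<or> u = p'"
      "\<And>u. {u, p} \<in> E \<longleftrightarrow> u = a \<or> u = q \<or> u = p'"
      by (rule cubic_nbs2[OF E pre]) (rule that)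
    have pre: "{q, b} \<in> E" "{q, p} \<in> E" "b \<noteq> p"
      using D(1) pq by (auto simp: a b adj adj')
    obtain q' where q: "distinct [q, b, p, q']" "\<And>u. {q, u} \<in> E \<longleftrightarrow> u = b \<or> u = p \<or> u = q'"
      "\<And>u. {u, q} \<in> E \<longleftrightarrow> u = b \<or> u = p \<or> u = q'"
      by (rule cubic_nbs2[OF E pre]) (rule that)
    have pq': "distinct [a, b, c, d, p, q, p']" "distinct [a, b, c, d, p, q, q']"
      using pq p(1) q(1) p(2)[of p'] q(2)[of q'] a(2)[of q] b(2)[of p]
        p(3)[of b] q(3)[of a] c(2)[of p] d(2)[of p] c(2)[of q] d(2)[of q] a(3)[of q] b(3)[of p] by auto
    \<comment> \<open>The edge to be broken. That \<open>v\<close> differs from \<open>p'\<close>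
      keeps \<open>{v, p}\<close> free for the make move; that \<open>u\<close> differs from
      \<open>q'\<close> keeps \<open>a\<close> and \<open>q'\<close> nonadjacent at the end.\<close>
    have "\<exists>u v. {u, v} \<in> E \<and> distinct [a, b, c, d, p, q, q', u] \<and> distinct [a, b, c, d, p, q, p', v] \<and> u \<noteq> v"
    proof (cases "p' = q'")
      case False
      have pre: "{p', p} \<in> E"
        by (simp add: p insert_commute)
      obtain v where v: "{p', v} \<in> E" "v \<noteq> p" "v \<noteq> p'"
        by (rule cubic_other_nb[OF E pre]) (rule that)
      have "distinct [a, b, c, d, p, q, p', v]"
        using v False pq' a(3)[of p'] b(3)[of p'] c(2)[of p'] d(2)[of p'] q(3)[of p'] by auto
      then show ?thesis using pq' False v by (intro exI[of _ p'] exI[of _ v]) auto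
    next
      case True
      have pre: "{p', p} \<in> E" "{p', q} \<in> E" "p \<noteq> q"
        using adj(1) by (auto simp: p q True)
      obtain s where r: "distinct [p', p, q, s]" "\<And>u. {p', u} \<in> E \<longleftrightarrow> u = p \<or> u = q \<or> u = s"
        "\<And>u. {u, p'} \<in> E \<longleftrightarrow> u = p \<or> u = q \<or> u = s"
        by (rule cubic_nbs2[OF E pre]) (rule that)
      have s: "distinct [a, b, c, d, p, q, p', s]"
        using r(1) r(2)[of s] pq' a(3)[of p'] b(3)[of p'] c(2)[of p'] d(2)[of p'] by auto
      have pre: "{s, p'} \<in> E"
        by (simp add: r insert_commute)
      obtain t where t: "{s, t} \<in> E" "t \<noteq> p'" "t \<noteq> s"
        by (rule cubic_other_nb[OF E pre]) (rule that)
      have "distinct [a, b, c, d, p, q, p', t]"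
        using t s pq' True a(3)[of s] b(3)[of s] c(2)[of s] d(2)[of s] p(3)[of s] q(3)[of s] by auto
      then show ?thesis using s True t by (intro exI[of _ s] exI[of _ t]) auto
    qed
    then obtain u v where uv: "{u, v} \<in> E" "distinct [a, b, c, d, p, q, q', u]"
      "distinct [a, b, c, d, p, q, p', v]" "u \<noteq> v" by blast
    \<comment> \<open>After both moves the diamond has the ends \<open>d\<close>, \<open>q\<close>,
      the middle edge \<open>{b, c}\<close>, and \<open>a\<close>, \<open>q'\<close> as third
      neighbours of its ends.\<close>
    let ?E1 = "break E a c u v"
    have 1: "break_applicable E d a c u v"
      using uv by (auto simp: break_applicable_def a b c d)
    let ?E2 = "make ?E1 v c q p"
    have 2: "make_applicable ?E1 v c b q p"
      using uv pq' by (auto simp: make_applicable_def move_iffs a b c d p q)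
    have "K4able ?E2"
      by (rule K4able_diamond_ends[of d q b c a q'])
        (use uv pq' in \<open>auto simp: move_iffs a b c d p q\<close>)
    then show ?thesis using break_step[OF 1] make_step[OF 2] K4able_reach by blast
  qed
qed

section \<open>Extending a triangle to a diamond\<close>

text \<open>The make move along \<open>x' x v v' z\<close> joins \<open>v'\<close> to
  \<open>x\<close>, so that \<open>{v, x}\<close> becomes the middle edge of a diamond with ends
  \<open>v'\<close> and \<open>t\<close>. If \<open>{x, v'}\<close> is already an edge, the diamond
  is there without a move.\<close>

lemma K4able_triangle_outer:
  assumes E: "cubic_on V E" and D: "distinct [v, x, t]" "v' \<notin> {v, x, t}" "x' \<notin> {v, x, t}"
    "{v, x} \<in> E" "{v, t} \<in> E" "{x, t} \<in> E" "{v, v'} \<in> E" "{x, x'} \<in> E"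
    "{v', z} \<in> E" "z \<noteq> v" "z \<noteq> x'" "{x', z} \<notin> E"
  shows "K4able E"
proof (cases "{x, v'} \<in> E")
  case True
  show ?thesis
    by (rule K4able_diamond[OF E, of v' t v x]) (use D True in \<open>auto simp: insert_commute\<close>)
next
  case False
  have d: "distinct [x', x, v, v', z]" using D False cubic_edge(3)[OF E D(9)] by (auto simp: insert_commute)
  let ?E = "make E x' x v' z"
  have 1: "make_applicable E x' x v v' z"
    using d D False by (auto simp: make_applicable_def insert_commute)
  then have E': "cubic_on V ?E" using cubic_on_switch[OF E] triangle_switch_make by blast
  have "K4able ?E"
    by (rule K4able_diamond[OF E', of v' t v x])
      (use D d in \<open>auto simp: move_iffs insert_commute\<close>)
  then show ?thesis using make_step[OF 1] K4able_reach by blast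
qed

text \<open>Contrapositive of \<open>K4able_triangle_outer\<close>, the form in which a triangle
  admitting no such make move is analysed.\<close>

lemma outer_nbs_relation:
  assumes E: "cubic_on V E" "\<not> K4able E" and D: "distinct [v, x, t]"
    "{v, x} \<in> E" "{v, t} \<in> E" "{x, t} \<in> E" "{v, v'} \<in> E" "v' \<notin> {x, t}"
    "{x, x'} \<in> E" "x' \<notin> {v, t}" "{v', z} \<in> E" "z \<noteq> v"
  shows "z = x' \<or> {x', z} \<in> E"
  using K4able_triangle_outer[OF E(1), of v x t v' x' z] assms cubic_edge(3)[OF E(1)] by auto

text \<open>If no outer neighbours \<open>v'\<close>, \<open>x'\<close>, \<open>t'\<close> of the triangle satisfy \<open>K4able_triangle_outer\<close>, then its
  component is either the prism or $K_{3,3}$ with one vertex replaced by a triangle.\<close>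

lemma K4able_triangle:
  assumes E: "cubic_on V E" and V: "card V \<noteq> 6" and D: "distinct [v, x, t]"
    "{v, x} \<in> E" "{v, t} \<in> E" "{x, t} \<in> E"
  shows "K4able E"
proof (rule ccontr)
  assume nK: "\<not> K4able E"
  have sym: "{x, v} \<in> E" "{t, v} \<in> E" "{t, x} \<in> E" using D by (auto simp: insert_commute)
  have pre: "{v, x} \<in> E" "{v, t} \<in> E" "x \<noteq> t"
    using D by (auto simp: insert_commute)
  obtain v' where v: "distinct [v, x, t, v']" "\<And>u. {v, u} \<in> E \<longleftrightarrow> u = x \<or> u = t \<or> u = v'"
     "\<And>u. {u, v} \<in> E \<longleftrightarrow> u = x \<or> u = t \<or> u = v'"
    by (rule cubic_nbs2[OF E pre]) (rule that)
  have pre: "{x, v} \<in> E" "{x, t} \<in> E" "v \<noteq> t"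
    using D sym by (auto simp: insert_commute)
  obtain x' where x: "distinct [x, v, t, x']" "\<And>u. {x, u} \<in> E \<longleftrightarrow> u = v \<or> u = t \<or> u = x'"
     "\<And>u. {u, x} \<in> E \<longleftrightarrow> u = v \<or> u = t \<or> u = x'"
    by (rule cubic_nbs2[OF E pre]) (rule that)
  have pre: "{t, v} \<in> E" "{t, x} \<in> E" "v \<noteq> x"
    using D sym by (auto simp: insert_commute)
  obtain t' where t: "distinct [t, v, x, t']" "\<And>u. {t, u} \<in> E \<longleftrightarrow> u = v \<or> u = x \<or> u = t'"
     "\<And>u. {u, t} \<in> E \<longleftrightarrow> u = v \<or> u = x \<or> u = t'"
    by (rule cubic_nbs2[OF E pre]) (rule that)
  \<comment> \<open>Two coinciding outer neighbours would complete the triangle to a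
    diamond.\<close>
  have "v' \<noteq> x'" using nK K4able_diamond[OF E, of t v' v x] v x t D sym by auto
  moreover have "v' \<noteq> t'" using nK K4able_diamond[OF E, of x v' v t] v x t D sym by auto
  moreover have "x' \<noteq> t'" using nK K4able_diamond[OF E, of v x' x t] v x t D sym by auto
  ultimately have d: "distinct [v, x, t, v', x', t']" using v x t by auto
  note edges = D sym v(2)[of v'] x(2)[of x'] t(2)[of t']
  have vx: "z = x' \<or> {x', z} \<in> E" if "{v', z} \<in> E" "z \<noteq> v" for z
    by (rule outer_nbs_relation[OF E nK, of v x t v']) (use that d edges in auto)
  have vt: "z = t' \<or> {t', z} \<in> E" if "{v', z} \<in> E" "z \<noteq> v" for z
    by (rule outer_nbs_relation[OF E nK, of v t x v']) (use that d edges in auto)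
  have xv: "z = v' \<or> {v', z} \<in> E" if "{x', z} \<in> E" "z \<noteq> x" for z
    by (rule outer_nbs_relation[OF E nK, of x v t x']) (use that d edges in auto)
  have xt: "z = t' \<or> {t', z} \<in> E" if "{x', z} \<in> E" "z \<noteq> x" for z
    by (rule outer_nbs_relation[OF E nK, of x t v x']) (use that d edges in auto)
  have tv: "z = v' \<or> {v', z} \<in> E" if "{t', z} \<in> E" "z \<noteq> t" for z
    by (rule outer_nbs_relation[OF E nK, of t v x t']) (use that d edges in auto)
  have tx: "z = x' \<or> {x', z} \<in> E" if "{t', z} \<in> E" "z \<noteq> t" for z
    by (rule outer_nbs_relation[OF E nK, of t x v t']) (use that d edges in auto)
  have pre: "{v', v} \<in> E"
    by (simp add: v)
  obtain z1 z2 where v': "distinct [v', v, z1, z2]" "\<And>u. {v', u} \<in> E \<longleftrightarrow> u = v \<or> u = z1 \<or> u = z2"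
     "\<And>u. {u, v'} \<in> E \<longleftrightarrow> u = v \<or> u = z1 \<or> u = z2"
    by (rule cubic_nbs1[OF E pre]) (rule that)
  show False
  proof (cases "{v', x'} \<in> E \<or> {v', t'} \<in> E \<or> {x', t'} \<in> E")
    case True
    \<comment> \<open>The relations pass an edge between two outer neighbours on to the third one,
      so a single such edge forces the prism.\<close>
    have prism: "{v', x'} \<in> E" "{v', t'} \<in> E" "{x', t'} \<in> E"
      using True d vt[of x'] xt[of v'] vx[of t'] tx[of v'] xv[of t'] tv[of x']
      by (auto simp: insert_commute)
    then have prism': "{x', v'} \<in> E" "{t', v'} \<in> E" "{t', x'} \<in> E"
      by (simp_all add: insert_commute)
    have pre: "{v', v} \<in> E" "{v', x'} \<in> E" "{v', t'} \<in> E" "distinct [v, x', t']"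
      using d by (auto simp: v prism prism')
    have v'': "{v', u} \<in> E \<longleftrightarrow> u = v \<or> u = x' \<or> u = t'" "{u, v'} \<in> E \<longleftrightarrow> u = v \<or> u = x' \<or> u = t'" for u
      by (rule cubic_nbs3[OF E pre])+
    have pre: "{x', x} \<in> E" "{x', v'} \<in> E" "{x', t'} \<in> E" "distinct [x, v', t']"
      using d by (auto simp: x prism prism')
    have x'': "{x', u} \<in> E \<longleftrightarrow> u = x \<or> u = v' \<or> u = t'" "{u, x'} \<in> E \<longleftrightarrow> u = x \<or> u = v' \<or> u = t'" for u
      by (rule cubic_nbs3[OF E pre])+
    have pre: "{t', t} \<in> E" "{t', v'} \<in> E" "{t', x'} \<in> E" "distinct [t, v', x']"
      using d by (auto simp: t prism prism')
    have t'': "{t', u} \<in> E \<longleftrightarrow> u = t \<or> u = v' \<or> u = x'" "{u, t'} \<in> E \<longleftrightarrow> u = t \<or> u = v' \<or> u = x'" for u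
      by (rule cubic_nbs3[OF E pre])+
    \<comment> \<open>The prism is a whole component with six vertices, so
      \<open>card V \<noteq> 6\<close> leaves an edge \<open>{u, w}\<close> disjoint from
      it.\<close>
    let ?P = "{v, x, t, v', x', t'}"
    have "?P \<subseteq> V" using cubic_edge[OF E] edges by blast
    moreover have "card ?P = 6" using d by auto
    ultimately have "?P \<subset> V" using V by (metis psubsetI)
    then obtain u where u: "u \<in> V" "u \<notin> ?P" by (rule psubset_imp_ex_mem[THEN exE]) blast
    obtain w where w: "{u, w} \<in> E" using cubic_nbs[OF E u(1)] by metis
    have "w \<noteq> v" "w \<noteq> x" "w \<noteq> t" "w \<noteq> v'" "w \<noteq> x'" "w \<noteq> t'"
      using u(2) w by (metis v(3) x(3) t(3) v''(2) x''(2) t''(2) insertCI)+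
    then have w': "u \<noteq> w" "w \<notin> ?P" using cubic_edge(3)[OF E w] by simp_all
    \<comment> \<open>The triangle \<open>v' x' t'\<close> survives. Its outer neighbours
      \<open>v\<close> and \<open>x\<close> are now separated by \<open>u\<close>, which is adjacent
      to \<open>v\<close> but not to \<open>x\<close>.\<close>
    let ?E = "break E v x u w"
    have 1: "break_applicable E t v x u w"
      using u w w' d by (auto simp: break_applicable_def v x t)
    then have E': "cubic_on V ?E" using cubic_on_switch[OF E] triangle_switch_break by blast
    have "K4able ?E"
      by (rule K4able_triangle_outer[OF E', of v' x' t' v x u])
        (use u w w' d in \<open>auto simp: move_iffs v x t v'' x'' t''\<close>)
    then show False using break_step[OF 1] K4able_reach nK by blast
  next
    case False
    \<comment> \<open>Without edges among them, \<open>v'\<close>, \<open>x'\<close> and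
      \<open>t'\<close> share the neighbours \<open>z1\<close> and \<open>z2\<close>: this is
      $K_{3,3}$ with one vertex replaced by the triangle.\<close>
    have z: "z1 \<notin> {v, x, t, v', x', t'}" "z2 \<notin> {v, x, t, v', x', t'}"
      using False v'(1) v'(2)[of z1] v'(2)[of z2] d by (auto simp: v x t)
    have zx: "{x', z1} \<in> E" "{x', z2} \<in> E" "{t', z1} \<in> E" "{t', z2} \<in> E"
      using vx[of z1] vx[of z2] vt[of z1] vt[of z2] v'(1) z by (auto simp: v')
    have pre: "{z1, v'} \<in> E" "{z1, x'} \<in> E" "{z1, t'} \<in> E" "distinct [v', x', t']"
      using zx d by (auto simp: v' insert_commute[of z1])
    have z1: "{z1, u} \<in> E \<longleftrightarrow> u = v' \<or> u = x' \<or> u = t'" "{u, z1} \<in> E \<longleftrightarrow> u = v' \<or> u = x' \<or> u = t'" for u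
      by (rule cubic_nbs3[OF E pre])+
    \<comment> \<open>This move creates the triangle \<open>x t t'\<close>. Its outer neighbours
      \<open>x'\<close> (of \<open>x\<close>) and \<open>v\<close> (of \<open>t\<close>) are
      separated by \<open>z2\<close>, which is adjacent to \<open>x'\<close> only.\<close>
    let ?E = "break E v x z1 t'"
    have 1: "break_applicable E t v x z1 t'"
      using z d by (auto simp: break_applicable_def v x t z1)
    then have E': "cubic_on V ?E" using cubic_on_switch[OF E] triangle_switch_break by blast
    have "K4able ?E"
      by (rule K4able_triangle_outer[OF E', of x t t' x' v z2])
        (use z zx d v'(1) in \<open>auto simp: move_iffs v x t v'\<close>)
    then show False using break_step[OF 1] K4able_reach nK by blast
  qed
qed

section \<open>Triangle-free graphs, and reaching a $K_4$ in general\<close>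

text \<open>If no make move had \<open>v\<close> in the middle, vertices reached in two steps
  through different neighbours of \<open>v\<close> would be distinct and adjacent
  (\<open>adj\<close>). One such vertex for each of the three neighbours would then give a
  triangle.\<close>

lemma make_applicable_if_triangle_free:
  assumes E: "cubic_on V E" and "v \<in> V"
    and free: "\<And>a b c. {a, b} \<in> E \<Longrightarrow> {b, c} \<in> E \<Longrightarrow> {a, c} \<notin> E"
  obtains y x w z where "make_applicable E y x v w z"
proof -
  have adj: "{y, z} \<in> E \<and> y \<noteq> z"
    if none: "\<And>y x w z. \<not> make_applicable E y x v w z" and *: "{v, x} \<in> E" "{v, w} \<in> E" "x \<noteq> w"
      "{x, y} \<in> E" "y \<noteq> v" "{w, z} \<in> E" "z \<noteq> v" for x w y z
  proof -
    have E1: "{y, z} \<in> E" if "{x, y} \<in> E" "y \<noteq> v" "{w, z} \<in> E" "z \<noteq> v" "y \<noteq> z" for y z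
    proof (rule ccontr)
      assume "{y, z} \<notin> E"
      have d: "x \<noteq> y" "x \<noteq> v" "v \<noteq> w" "w \<noteq> z"
        using cubic_edge(3)[OF E] that * by blast+
      have "{x, w} \<notin> E" using free[of x v w] * by (auto simp: insert_commute)
      then have "make_applicable E y x v w z"
        using \<open>{y, z} \<notin> E\<close> that * d unfolding make_applicable_def by (auto simp: insert_commute)
      then show False using none by blast
    qed
    \<comment> \<open>If \<open>y = z\<close>, then \<open>E1\<close> makes the remaining neighbour
      \<open>z2\<close> of \<open>w\<close> adjacent to \<open>z\<close>, and \<open>w z z2\<close>
      is a triangle.\<close>
    have "y \<noteq> z"
    proof
      assume "y = z"
      have pre: "{w, v} \<in> E" "{w, z} \<in> E" "v \<noteq> z"
        using * by (auto simp: insert_commute)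
      obtain z2 where z2: "distinct [w, v, z, z2]" "{w, z2} \<in> E"
        using cubic_nbs2[OF E pre] by metis
      have "{y, z2} \<in> E" using E1[of y z2] * z2 \<open>y = z\<close> by auto
      then show False using free[of w z z2] * z2 \<open>y = z\<close> by auto
    qed
    then show ?thesis using E1 * by auto
  qed
  show ?thesis
  proof (rule ccontr)
    assume "\<not> ?thesis"
    then have none: "\<And>y x w z. \<not> make_applicable E y x v w z" using that by blast
    obtain x w u where v: "distinct [v, x, w, u]" "{v, x} \<in> E" "{v, w} \<in> E" "{v, u} \<in> E"
      using cubic_nbs[OF E \<open>v \<in> V\<close>] by metis
    have pre: "{x, v} \<in> E"
      using v by (auto simp: insert_commute)
    obtain y1 y2 where y: "distinct [x, v, y1, y2]" "{x, y1} \<in> E" "{x, y2} \<in> E"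
      using cubic_nbs1[OF E pre] by metis
    have pre: "{w, v} \<in> E"
      using v by (auto simp: insert_commute)
    obtain z1 z2 where z: "distinct [w, v, z1, z2]" "{w, z1} \<in> E" "{w, z2} \<in> E"
      using cubic_nbs1[OF E pre] by metis
    have pre: "{u, v} \<in> E"
      using v by (auto simp: insert_commute)
    obtain u1 u2 where u: "distinct [u, v, u1, u2]" "{u, u1} \<in> E" "{u, u2} \<in> E"
      using cubic_nbs1[OF E pre] by metis
    note A = adj[OF none]
    have yz: "{y1, z1} \<in> E \<and> y1 \<noteq> z1" "{y1, z2} \<in> E \<and> y1 \<noteq> z2"
      "{y2, z1} \<in> E \<and> y2 \<noteq> z1"
      by (rule A[of x w]; use v y z in auto)+
    have yu: "{y1, u1} \<in> E \<and> y1 \<noteq> u1" by (rule A[of x u]; use v y u in auto)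
    have zu: "{z1, u1} \<in> E \<and> z1 \<noteq> u1" "{z2, u1} \<in> E \<and> z2 \<noteq> u1"
      by (rule A[of w u]; use v z u in auto)+
    have "{u1, z1} \<in> E" using zu by (simp add: insert_commute)
    then show False using free[of y1 u1 z1] yu yz by blast
  qed
qed

lemma K4able_if_card_ne_6:
  assumes E: "cubic_on V E" and V: "V \<noteq> {}" "card V \<noteq> 6"
  shows "K4able E"
proof (cases "\<forall>a b c. {a, b} \<in> E \<longrightarrow> {b, c} \<in> E \<longrightarrow> {a, c} \<notin> E")
  case True
  obtain v where "v \<in> V" using V by blast
  then obtain y x w z where m: "make_applicable E y x v w z"
    using make_applicable_if_triangle_free[OF E \<open>v \<in> V\<close>] True by metis
  then have E': "cubic_on V (make E y x w z)"
    using cubic_on_switch[OF E] triangle_switch_make by blast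
  have "K4able (make E y x w z)"
    by (rule K4able_triangle[OF E' V(2), of x v w])
      (use m in \<open>auto simp: make_applicable_def move_iffs insert_commute\<close>)
  then show ?thesis using make_step[OF m] K4able_reach by blast
next
  case False
  then obtain a b c where "{a, b} \<in> E" "{b, c} \<in> E" "{a, c} \<in> E" by blast
  then show ?thesis using K4able_triangle[OF E V(2), of a b c] cubic_edge(3)[OF E] by auto
qed

section \<open>Comparing cubic graphs; moving a $K_4$ and splitting it off\<close>

text \<open>Neighbourhoods that all have size 3 cannot be properly nested.\<close>

lemma cubic_subset_eq:
  assumes E: "cubic_on V E" and E': "cubic_on V E'" and sub: "\<And>u v. {u, v} \<in> E \<Longrightarrow> {u, v} \<in> E'"
  shows "E = E'"
proof -
  have nbs: "nbs E v = nbs E' v" if "v \<in> V" for v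
  proof (rule card_subset_eq)
    show "finite (nbs E' v)" using E' that unfolding cubic_on_def by (auto intro: card_ge_0_finite)
    show "card (nbs E v) = card (nbs E' v)" using E E' that unfolding cubic_on_def by auto
  qed (auto simp: nbs_def sub)
  have "e \<in> E" if e: "e \<in> E'" for e
  proof -
    obtain u v where "e = {u, v}" "u \<in> V" using cubic_edge_cases[OF E' e] by metis
    then show ?thesis using nbs[of u] e unfolding nbs_def by blast
  qed
  moreover have "e \<in> E'" if e: "e \<in> E" for e
  proof -
    obtain u v where "e = {u, v}" using cubic_edge_cases[OF E e] by metis
    then show ?thesis using sub e by blast
  qed
  ultimately show ?thesis by blast
qed

lemma cubic_nbs_eq:
  assumes "cubic_on V E" "v \<in> V" "finite B" "card B \<le> 3" "nbs E v \<subseteq> B"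
  shows "nbs E v = B"
  using assms card_seteq[of B "nbs E v"] unfolding cubic_on_def by auto

text \<open>Together the four moves exchange the neighbourhoods of \<open>a\<close> and
  \<open>q\<close>: the vertex \<open>a\<close> inherits \<open>p\<close>, \<open>z\<close>,
  \<open>q'\<close>, and \<open>q\<close> inherits \<open>b\<close>, \<open>c\<close>,
  \<open>d\<close>.\<close>

lemma clique4_insert:
  assumes E: "cubic_on V E" and A: "clique4 E A" and a: "a \<in> A" and q: "q \<in> V" "q \<notin> A"
  obtains E' where "reach E E'" "clique4 E' (insert q (A - {a}))"
proof -
  have "finite A" "card (A - {a}) = 3"
    using A a unfolding clique4_def by (auto intro: card_ge_0_finite)
  then obtain b c d where bcd: "A - {a} = {b, c, d}" "b \<noteq> c" "b \<noteq> d" "c \<noteq> d"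
    by (auto simp: card_3_iff)
  then have A': "A = {a, b, c, d}" using a by auto
  have D: "distinct [a, b, c, d]" using bcd by auto
  have K: "{a, b} \<in> E" "{a, c} \<in> E" "{a, d} \<in> E" "{b, c} \<in> E" "{b, d} \<in> E" "{c, d} \<in> E"
    "{b, a} \<in> E" "{c, a} \<in> E" "{d, a} \<in> E" "{c, b} \<in> E" "{d, b} \<in> E" "{d, c} \<in> E"
    using A D unfolding clique4_def A' by auto
  have pre: "{a, b} \<in> E" "{a, c} \<in> E" "{a, d} \<in> E" "distinct [b, c, d]" using K D by auto
  have a: "{a, u} \<in> E \<longleftrightarrow> u = b \<or> u = c \<or> u = d" "{u, a} \<in> E \<longleftrightarrow> u = b \<or> u = c \<or> u = d" for u
    by (rule cubic_nbs3[OF E pre])+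
  have pre: "{b, a} \<in> E" "{b, c} \<in> E" "{b, d} \<in> E" "distinct [a, c, d]" using K D by auto
  have b: "{b, u} \<in> E \<longleftrightarrow> u = a \<or> u = c \<or> u = d" "{u, b} \<in> E \<longleftrightarrow> u = a \<or> u = c \<or> u = d" for u
    by (rule cubic_nbs3[OF E pre])+
  have pre: "{c, a} \<in> E" "{c, b} \<in> E" "{c, d} \<in> E" "distinct [a, b, d]" using K D by auto
  have c: "{c, u} \<in> E \<longleftrightarrow> u = a \<or> u = b \<or> u = d" "{u, c} \<in> E \<longleftrightarrow> u = a \<or> u = b \<or> u = d" for u
    by (rule cubic_nbs3[OF E pre])+
  have pre: "{d, a} \<in> E" "{d, b} \<in> E" "{d, c} \<in> E" "distinct [a, b, c]" using K D by auto
  have d: "{d, u} \<in> E \<longleftrightarrow> u = a \<or> u = b \<or> u = c" "{u, d} \<in> E \<longleftrightarrow> u = a \<or> u = b \<or> u = c" for u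
    by (rule cubic_nbs3[OF E pre])+
  obtain p z q' where n: "distinct [q, p, z, q']" "\<And>u. {q, u} \<in> E \<longleftrightarrow> u = p \<or> u = z \<or> u = q'"
    "\<And>u. {u, q} \<in> E \<longleftrightarrow> u = p \<or> u = z \<or> u = q'"
    by (rule cubic_nbs[OF E q(1)]) (rule that)
  have q1: "q \<noteq> a" "q \<noteq> b" "q \<noteq> c" "q \<noteq> d" using q A' by auto
  have out: "u \<notin> {a, b, c, d}" if "{u, w} \<in> E" "w \<notin> {a, b, c, d}" for u w
    using that a(1)[of w] b(1)[of w] c(1)[of w] d(1)[of w] by auto
  have o: "p \<notin> {a, b, c, d}" "z \<notin> {a, b, c, d}" "q' \<notin> {a, b, c, d}"
    using out[of p q] out[of z q] out[of q' q] n(3)[of p] n(3)[of z] n(3)[of q'] q1 by auto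
  have "{z, q} \<in> E" by (simp add: n)
  then obtain v where v: "{z, v} \<in> E" "v \<noteq> q" "v \<noteq> z" by (rule cubic_other_nb[OF E])
  have v': "{v, z} \<in> E" using v by (simp add: insert_commute)
  have ov: "v \<notin> {a, b, c, d}" using out[of v z] v' o by auto
  let ?E1 = "break E a b p q"
  have 1: "break_applicable E c a b p q"
    using D q1 o n(1) by (auto simp: break_applicable_def a b c n)
  \<comment> \<open>The edge \<open>{z, v}\<close> is only borrowed: this move removes it, attaching
    \<open>v\<close> to \<open>c\<close> and \<open>z\<close> to \<open>a\<close>, and the next one
    restores it while \<open>c\<close> trades \<open>v\<close> for \<open>q\<close>.\<close>
  let ?E2 = "break ?E1 a c z v"
  have 2: "break_applicable ?E1 d a c z v"
    using D q1 o ov n(1) v v' by (auto simp: break_applicable_def move_iffs a b c d n)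
  let ?E3 = "make ?E2 v c q z"
  have 3: "make_applicable ?E2 v c b q z"
    using D q1 o ov n(1) v v' by (auto simp: make_applicable_def move_iffs a b c d n)
  let ?E4 = "make ?E3 a d q q'"
  have 4: "make_applicable ?E3 a d b q q'"
    using D q1 o ov n(1) v v' by (auto simp: make_applicable_def move_iffs a b c d n)
  have "clique4 ?E4 {q, b, c, d}"
    by (rule clique4I) (use D q1 o ov n(1) v v' in \<open>auto simp: move_iffs a b c d n\<close>)
  moreover have "insert q (A - {a}) = {q, b, c, d}" using bcd by auto
  moreover have "reach E ?E4"
    using break_step[OF 1] break_step[OF 2] make_step[OF 3] make_step[OF 4] by (meson rtranclp_trans)
  ultimately show ?thesis using that by metis
qed

text \<open>Each exchange by \<open>clique4_insert\<close> brings one more vertex of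
  \<open>B\<close> into the clique and gives up one outside \<open>B\<close>, so
  \<open>card (B - A)\<close> decreases.\<close>

lemma clique4_move:
  assumes "cubic_on V E" "clique4 E A" "B \<subseteq> V" "finite B" "card B = 4"
  obtains E' where "reach E E'" "clique4 E' B"
  using assms
proof (induction "card (B - A)" arbitrary: E A thesis rule: less_induct)
  case less
  have A: "finite A" "card A = 4" using less.prems(3) unfolding clique4_def by (auto intro: card_ge_0_finite)
  show ?case
  proof (cases "B \<subseteq> A")
    case True
    then have "B = A" using card_subset_eq[OF A(1) True] A less.prems(6) by simp
    then show ?thesis using less.prems by blast
  next
    case False
    then obtain q where q: "q \<in> B" "q \<notin> A" by blast
    have "\<not> A \<subseteq> B" using False A less.prems(5,6) by (metis card_subset_eq subset_refl)
    then obtain a where a: "a \<in> A" "a \<notin> B" by blast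
    obtain E1 where E1: "reach E E1" "clique4 E1 (insert q (A - {a}))"
      using clique4_insert[OF less.prems(2,3) a(1)] q less.prems(4) by blast
    have "B - insert q (A - {a}) \<subset> B - A" using q a by blast
    then have lt: "card (B - insert q (A - {a})) < card (B - A)"
      using less.prems(5) by (simp add: psubset_card_mono)
    obtain E' where "reach E1 E'" "clique4 E' B"
      using less.hyps[OF lt _ cubic_on_reach[OF E1(1) less.prems(2)] E1(2) less.prems(4-6)] by metis
    then show ?thesis using less.prems(1) E1(1) by (meson rtranclp_trans)
  qed
qed

text \<open>Inside \<open>A\<close> every vertex already has its three neighbours, so no edge leaves
  \<open>A\<close>. The edges within \<open>A\<close> are determined by \<open>A\<close> alone,
  hence common to all graphs in which \<open>A\<close> is a clique.\<close>

lemma clique4_split: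
  assumes E: "cubic_on V E" and A: "clique4 E A"
  shows "A \<subseteq> V" "cubic_on (V - A) {e \<in> E. \<not> e \<subseteq> A}" "{e \<in> E. e \<subseteq> A} = {e. e \<subseteq> A \<and> card e = 2}"
    "\<And>e. e \<in> E \<Longrightarrow> \<not> e \<subseteq> A \<Longrightarrow> e \<inter> A = {}"
proof -
  have fA: "finite A" "card A = 4" using A unfolding clique4_def by (auto intro: card_ge_0_finite)
  show AV: "A \<subseteq> V"
  proof
    fix u assume u: "u \<in> A"
    have "card (A - {u}) = 3" using fA u by simp
    then have "A - {u} \<noteq> {}" by (metis card.empty zero_neq_numeral)
    then obtain v where "v \<in> A - {u}" by blast
    then have "{u, v} \<in> E" using A u unfolding clique4_def by auto
    then show "u \<in> V" using cubic_edge(1)[OF E] by blast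
  qed
  have nA: "nbs E u = A - {u}" if u: "u \<in> A" for u
  proof (rule sym, rule card_subset_eq)
    show "finite (nbs E u)" using E u AV unfolding cubic_on_def by (intro card_ge_0_finite) auto
    show "A - {u} \<subseteq> nbs E u" using A u unfolding clique4_def nbs_def by auto
    show "card (A - {u}) = card (nbs E u)" using E u AV fA unfolding cubic_on_def by auto
  qed
  show dis: "e \<inter> A = {}" if e: "e \<in> E" "\<not> e \<subseteq> A" for e
  proof -
    obtain u v where uv: "e = {u, v}" using cubic_edge_cases[OF E e(1)] by metis
    have "v \<in> A" if "u \<in> A" using nA[OF that] e uv unfolding nbs_def by blast
    moreover have "u \<in> A" if "v \<in> A"
      using nA[OF that] e uv unfolding nbs_def by (auto simp: insert_commute)
    ultimately show ?thesis using uv e(2) by blast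
  qed
  show "{e \<in> E. e \<subseteq> A} = {e. e \<subseteq> A \<and> card e = 2}"
  proof
    show "{e \<in> E. e \<subseteq> A} \<subseteq> {e. e \<subseteq> A \<and> card e = 2}" using E unfolding cubic_on_def by auto
    show "{e. e \<subseteq> A \<and> card e = 2} \<subseteq> {e \<in> E. e \<subseteq> A}"
      using A unfolding clique4_def by (auto simp: card_2_iff)
  qed
  show "cubic_on (V - A) {e \<in> E. \<not> e \<subseteq> A}"
    unfolding cubic_on_def
  proof (intro conjI ballI)
    fix e assume "e \<in> {e \<in> E. \<not> e \<subseteq> A}"
    then show "e \<subseteq> V - A" "card e = 2" using dis[of e] E unfolding cubic_on_def by auto
  next
    fix v assume v: "v \<in> V - A"
    then have "nbs {e \<in> E. \<not> e \<subseteq> A} v = nbs E v" unfolding nbs_def by auto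
    then show "card (nbs {e \<in> E. \<not> e \<subseteq> A} v) = 3" using E v unfolding cubic_on_def by auto
  qed
qed

text \<open>A switch of \<open>F\<close> tests and changes only pairs inside \<open>W\<close>, and
  \<open>K\<close> contains no such pair.\<close>

lemma switch_union:
  assumes F: "cubic_on W F" and K: "\<And>e. e \<in> K \<Longrightarrow> e \<inter> W = {}" and s: "triangle_switch F F'"
  shows "triangle_switch (F \<union> K) (F' \<union> K)"
proof -
  have nK: "{x, y} \<notin> K" if "x \<in> W" for x y using K that by auto
  show ?thesis using s unfolding triangle_switch_def[of F]
  proof (elim disjE exE conjE)
    fix y x v w z assume m: "make_applicable F y x v w z" and F': "F' = make F y x w z"
    then have W: "x \<in> W" "y \<in> W" "w \<in> W" "z \<in> W" "v \<in> W"
      using cubic_edge[OF F] unfolding make_applicable_def by blast+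
    have "make_applicable (F \<union> K) y x v w z"
      using m nK W unfolding make_applicable_def by auto
    moreover have "make (F \<union> K) y x w z = F' \<union> K"
      using nK W unfolding make_def F' by blast
    ultimately show ?thesis using triangle_switch_make by metis
  next
    fix y x v w z assume m: "break_applicable F v x w y z" and F': "F' = break F x w y z"
    then have W: "x \<in> W" "y \<in> W" "w \<in> W" "z \<in> W" "v \<in> W"
      using cubic_edge[OF F] unfolding break_applicable_def by blast+
    have "break_applicable (F \<union> K) v x w y z"
      using m nK W unfolding break_applicable_def by auto
    moreover have "break (F \<union> K) x w y z = F' \<union> K"
      using nK W unfolding break_def F' by blast
    ultimately show ?thesis using triangle_switch_break by metis
  qed
qed

lemma reach_union:
  assumes "reach F F'" "cubic_on W F" "\<And>e. e \<in> K \<Longrightarrow> e \<inter> W = {}"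
  shows "reach (F \<union> K) (F' \<union> K)"
  using assms
proof (induction rule: rtranclp_induct)
  case (step G H)
  then have "triangle_switch (G \<union> K) (H \<union> K)"
    using switch_union[OF cubic_on_reach[OF step.hyps(1) step.prems(1)]] by blast
  then show ?case using step by (meson rtranclp.rtrancl_into_rtrancl)
qed simp


section \<open>Graphs on six vertices: the prism and $K_{3,3}$\<close>

text \<open>Only the edges between the parts are demanded: in a cubic graph on
  \<open>X \<union> Y\<close> they exhaust all degrees, so the graph is $K_{3,3}$ and determined by
  its parts (\<open>bipartite33_unique\<close>).\<close>

definition bipartite33 :: "graph \<Rightarrow> nat set \<Rightarrow> nat set \<Rightarrow> bool" where
  "bipartite33 E X Y \<longleftrightarrow> card X = 3 \<and> card Y = 3 \<and> X \<inter> Y = {} \<and> (\<forall>x\<in>X. \<forall>y\<in>Y. {x, y} \<in> E)"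

lemma bipartite33_sym:
  assumes "bipartite33 E X Y"
  shows "bipartite33 E Y X"
proof -
  have "{y, x} \<in> E" if "x \<in> X" "y \<in> Y" for x y
    using assms that unfolding bipartite33_def by (simp add: insert_commute)
  then show ?thesis using assms unfolding bipartite33_def by auto
qed

lemma bipartite33_nbs:
  assumes "cubic_on V E" "bipartite33 E X Y" "x \<in> V" "x \<in> X" "{x, u} \<in> E"
  shows "u \<in> Y"
proof -
  have "finite (nbs E x)" "card (nbs E x) = 3"
    using assms unfolding cubic_on_def by (auto intro: card_ge_0_finite)
  moreover have "Y \<subseteq> nbs E x" "card Y = 3" using assms unfolding bipartite33_def nbs_def by auto
  ultimately have "Y = nbs E x" by (simp add: card_subset_eq)
  then show ?thesis using assms(5) unfolding nbs_def by blast
qed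

lemma bipartite33_unique:
  assumes "cubic_on (X \<union> Y) E" "cubic_on (X \<union> Y) E'" "bipartite33 E X Y" "bipartite33 E' X Y"
  shows "E = E'"
proof (rule cubic_subset_eq[OF assms(1,2)])
  fix u v assume uv: "{u, v} \<in> E"
  then have "u \<in> X \<union> Y" using cubic_edge[OF assms(1)] by blast
  then show "{u, v} \<in> E'"
  proof
    assume "u \<in> X"
    then have "v \<in> Y" using bipartite33_nbs[OF assms(1,3) _ _ uv] by blast
    then show ?thesis using \<open>u \<in> X\<close> assms(4) unfolding bipartite33_def by blast
  next
    assume "u \<in> Y"
    then have "v \<in> X" using bipartite33_nbs[OF assms(1) bipartite33_sym[OF assms(3)] _ _ uv] by blast
    then have "{v, u} \<in> E'" using \<open>u \<in> Y\<close> assms(4) unfolding bipartite33_def by blast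
    then show ?thesis by (simp add: insert_commute)
  qed
qed

text \<open>A make move followed by a break move acts on $K_{3,3}$ as the transposition of \<open>a\<close> and \<open>b\<close>.\<close>

lemma bipartite33_swap:
  assumes E: "cubic_on V E" and B: "bipartite33 E X Y" "X \<subseteq> V" "Y \<subseteq> V" and a: "a \<in> X" and b: "b \<in> Y"
  obtains E' where "reach E E'" "bipartite33 E' (insert b (X - {a})) (insert a (Y - {b}))"
proof -
  have "finite X" "card (X - {a}) = 2" "finite Y" "card (Y - {b}) = 2"
    using B a b unfolding bipartite33_def by (auto intro: card_ge_0_finite)
  \<comment> \<open>The names refer to the prism after the make move, with triangles
    \<open>a a2 a3\<close> and \<open>b b2 b3\<close> and equal indices matched. In $K_{3,3}$ the
    vertices \<open>a3\<close> and \<open>b3\<close> therefore lie in the part of the other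
    letter.\<close>
  then obtain a2 b3 b2 a3 where Xa: "X - {a} = {a2, b3}" "a2 \<noteq> b3" and Yb: "Y - {b} = {b2, a3}" "b2 \<noteq> a3"
    by (auto simp: card_2_iff)
  then have XY: "X = {a, a2, b3}" "Y = {b, b2, a3}" using a b by auto
  have D: "distinct [a, a2, b3, b, b2, a3]"
    using Xa Yb B(1) unfolding XY bipartite33_def by auto
  have K0: "{x, y} \<in> E" and K1: "{y, x} \<in> E" if "x \<in> X" "y \<in> Y" for x y
    using B(1) that unfolding bipartite33_def by (simp_all add: insert_commute)
  have K: "{a, b} \<in> E" "{a, b2} \<in> E" "{a, a3} \<in> E" "{a2, b} \<in> E" "{a2, b2} \<in> E" "{a2, a3} \<in> E"
    "{b3, b} \<in> E" "{b3, b2} \<in> E" "{b3, a3} \<in> E" "{b, a} \<in> E" "{b2, a} \<in> E" "{a3, a} \<in> E"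
    "{b, a2} \<in> E" "{b2, a2} \<in> E" "{a3, a2} \<in> E" "{b, b3} \<in> E" "{b2, b3} \<in> E" "{a3, b3} \<in> E"
    by (simp_all add: K0 K1 XY)
  have nK: "{u, v} \<notin> E" if "u \<in> X" "v \<in> X" for u v
    using bipartite33_nbs[OF E B(1), of u v] that B unfolding bipartite33_def by blast
  have nK': "{u, v} \<notin> E" if "u \<in> Y" "v \<in> Y" for u v
    using bipartite33_nbs[OF E bipartite33_sym[OF B(1)], of u v] that B unfolding bipartite33_def by blast
  have n: "{a, a2} \<notin> E" "{a, b3} \<notin> E" "{a3, b} \<notin> E" "{b2, b} \<notin> E"
    using nK nK' XY by auto
  let ?E1 = "make E b2 a a2 b"
  have 1: "make_applicable E b2 a a3 a2 b"
    using D K n by (auto simp: make_applicable_def)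
  let ?E2 = "break ?E1 a a3 b3 b"
  have 2: "break_applicable ?E1 a2 a a3 b3 b"
    using D K n by (auto simp: break_applicable_def move_iffs)
  have "bipartite33 ?E2 {b, a2, b3} {a, b2, a3}"
    using D K unfolding bipartite33_def by (auto simp: move_iffs)
  moreover have "insert b (X - {a}) = {b, a2, b3}" "insert a (Y - {b}) = {a, b2, a3}"
    using Xa Yb by auto
  moreover have "reach E ?E2" using make_step[OF 1] break_step[OF 2] by (meson rtranclp_trans)
  ultimately show ?thesis using that by metis
qed

text \<open>Without triangles the graph is $K_{3,3}$, one part being the neighbourhood of any
  vertex. With a triangle it is the prism, or would have too few vertices to meet the degrees, and
  one break move leads to $K_{3,3}$.\<close>

lemma cubic6_reach_bipartite33:
  assumes E: "cubic_on V E" and V: "card V = 6"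
  obtains E' X Y where "reach E E'" "bipartite33 E' X Y" "X \<union> Y = V"
proof -
  have fV: "finite V" "V \<noteq> {}" using V by (auto intro: card_ge_0_finite)
  show ?thesis
  proof (cases "\<exists>a b c. {a, b} \<in> E \<and> {b, c} \<in> E \<and> {a, c} \<in> E")
    case False
    then have free: "{a, c} \<notin> E" if "{a, b} \<in> E" "{b, c} \<in> E" for a b c using that by blast
    obtain v where v: "v \<in> V" using fV by blast
    let ?Y = "nbs E v"
    have Y: "?Y \<subseteq> V" "card ?Y = 3" using cubic_edge[OF E] E v unfolding nbs_def cubic_on_def by auto
    then have fY: "finite ?Y" by (auto intro: card_ge_0_finite)
    have c3: "card (V - ?Y) = 3" using Y V fY by (simp add: card_Diff_subset)
    \<comment> \<open>Triangle-freeness keeps the neighbours of \<open>y\<close> out of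
      \<open>?Y\<close>, which leaves exactly three candidates.\<close>
    have "nbs E y = V - ?Y" if y: "y \<in> ?Y" for y
    proof (rule cubic_nbs_eq[OF E])
      show "nbs E y \<subseteq> V - ?Y"
      proof
        fix u assume "u \<in> nbs E y"
        then have "{y, u} \<in> E" "{v, y} \<in> E" using y unfolding nbs_def by auto
        then show "u \<in> V - ?Y" using free[of v y u] cubic_edge[OF E] unfolding nbs_def by blast
      qed
    qed (use y Y c3 fV in auto)
    then have "bipartite33 E ?Y (V - ?Y)" using Y c3 unfolding bipartite33_def nbs_def by auto
    then show ?thesis using that[of E ?Y "V - ?Y"] Y by blast
  next
    case True
    then obtain v x t where T: "{v, x} \<in> E" "{v, t} \<in> E" "{x, t} \<in> E" by (metis insert_commute)
    then have T': "{x, v} \<in> E" "{t, v} \<in> E" "{t, x} \<in> E" by (auto simp: insert_commute)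
    have D: "v \<noteq> x" "v \<noteq> t" "x \<noteq> t" using cubic_edge(3)[OF E] T by blast+
    have TV: "{v, x, t} \<subseteq> V" using cubic_edge[OF E] T by blast
    obtain v' where v: "distinct [v, x, t, v']" "\<And>u. {v, u} \<in> E \<longleftrightarrow> u = x \<or> u = t \<or> u = v'"
       "\<And>u. {u, v} \<in> E \<longleftrightarrow> u = x \<or> u = t \<or> u = v'"
      by (rule cubic_nbs2[OF E T(1) T(2) D(3)]) (rule that)
    obtain x' where x: "distinct [x, v, t, x']" "\<And>u. {x, u} \<in> E \<longleftrightarrow> u = v \<or> u = t \<or> u = x'"
       "\<And>u. {u, x} \<in> E \<longleftrightarrow> u = v \<or> u = t \<or> u = x'"
      by (rule cubic_nbs2[OF E T'(1) T(3) D(2)]) (rule that)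
    obtain t' where t: "distinct [t, v, x, t']" "\<And>u. {t, u} \<in> E \<longleftrightarrow> u = v \<or> u = x \<or> u = t'"
       "\<And>u. {u, t} \<in> E \<longleftrightarrow> u = v \<or> u = x \<or> u = t'"
      by (rule cubic_nbs2[OF E T'(2) T'(3) D(1)]) (rule that)
    let ?W = "V - {v, x, t}"
    have cW: "card ?W = 3" using V TV D fV by (simp add: card_Diff_subset)
    \<comment> \<open>Only two other vertices lie outside the triangle, so each vertex of
      \<open>?W\<close> has a neighbour in the triangle and is one of the outer neighbours.\<close>
    have sub: "?W \<subseteq> {v', x', t'}"
    proof
      fix u assume u: "u \<in> ?W"
      have c2: "card (?W - {u}) = 2" using cW u fV by simp
      have cn: "card (nbs E u) = 3" using E u unfolding cubic_on_def by auto
      have "\<not> nbs E u \<subseteq> ?W - {u}"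
        using card_mono[of "?W - {u}" "nbs E u"] fV c2 cn by auto
      then obtain w where w: "{u, w} \<in> E" "w \<notin> ?W - {u}" unfolding nbs_def by blast
      have "w \<in> {v, x, t}" using w cubic_edge[OF E w(1)] by auto
      then show "u \<in> {v', x', t'}" using w(1) u v(3)[of u] x(3)[of u] t(3)[of u] by auto
    qed
    have c3: "card {v', x', t'} \<le> 3" by (simp add: card_insert_if)
    have W: "?W = {v', x', t'}" using card_seteq[OF _ sub] cW c3 by simp
    then have D': "v' \<noteq> x'" "v' \<noteq> t'" "x' \<noteq> t'" using cW by (auto simp: card_insert_if split: if_splits)
    have d: "distinct [v, x, t, v', x', t']" using W D D' by auto
    have VW: "V = {v, x, t, v', x', t'}" using W TV by blast
    have "nbs E v' = {v, x', t'}"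
    proof (rule cubic_nbs_eq[OF E])
      show "nbs E v' \<subseteq> {v, x', t'}"
      proof
        fix u assume "u \<in> nbs E v'"
        then have u: "{v', u} \<in> E" unfolding nbs_def by auto
        have "u \<in> V" "u \<noteq> v'" using cubic_edge[OF E u] by auto
        moreover have "u \<noteq> x" "u \<noteq> t" using u d x(3)[of v'] t(3)[of v'] by auto
        ultimately show "u \<in> {v, x', t'}" using VW by blast
      qed
    qed (use VW D' d in auto)
    then have ne: "{v', u} \<in> E \<longleftrightarrow> u = v \<or> u = x' \<or> u = t'" for u unfolding nbs_def by blast
    have "nbs E x' = {x, v', t'}"
    proof (rule cubic_nbs_eq[OF E])
      show "nbs E x' \<subseteq> {x, v', t'}"
      proof
        fix u assume "u \<in> nbs E x'"
        then have u: "{x', u} \<in> E" unfolding nbs_def by auto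
        have "u \<in> V" "u \<noteq> x'" using cubic_edge[OF E u] by auto
        moreover have "u \<noteq> v" "u \<noteq> t" using u d v(3)[of x'] t(3)[of x'] by auto
        ultimately show "u \<in> {x, v', t'}" using VW by blast
      qed
    qed (use VW D' d in auto)
    then have nx: "{x', u} \<in> E \<longleftrightarrow> u = x \<or> u = v' \<or> u = t'" for u unfolding nbs_def by blast
    have P: "{v', x'} \<in> E" "{x', t'} \<in> E" "{v', t'} \<in> E" "{t', v'} \<in> E" "{x', v'} \<in> E" "{t', x'} \<in> E"
      using ne[of x'] ne[of t'] nx[of t'] by (simp_all add: insert_commute)
    \<comment> \<open>The parallel edges \<open>{v, t}\<close> and \<open>{v', t'}\<close> are
      replaced by the diagonals \<open>{v, t'}\<close> and \<open>{t, v'}\<close> of their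
      4-cycle.\<close>
    let ?E = "break E v t t' v'"
    have 1: "break_applicable E x v t t' v'"
      using d P by (auto simp: break_applicable_def v x t)
    have "bipartite33 ?E {v, x', t} {x, t', v'}"
      using d P unfolding bipartite33_def by (auto simp: move_iffs v x t)
    moreover have "{v, x', t} \<union> {x, t', v'} = V" using VW by auto
    ultimately show ?thesis using break_step[OF 1] that by blast
  qed
qed

text \<open>At most one transposition is required: after renaming the parts of \<open>E'\<close> if
  necessary, at most one vertex of its first part lies outside \<open>X\<close>. The fact
  \<open>near\<close> settles that situation with \<open>bipartite33_swap\<close>.\<close>

lemma reach_bipartite33:
  assumes "cubic_on V E" "cubic_on V E'" "bipartite33 E X Y" "bipartite33 E' X' Y'"
    "X \<union> Y = V" "X' \<union> Y' = V"
  shows "reach E E'"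
proof -
  have near: "reach E E'" if E': "cubic_on V E'" "bipartite33 E' X' Y'" "X' \<union> Y' = V"
    and two: "card (X' - X) \<le> 1" for X' Y'
  proof (cases "X' \<subseteq> X")
    case True
    have "X' = X" using True assms(3) E'(2) unfolding bipartite33_def
      by (metis card_subset_eq card.infinite zero_neq_numeral)
    moreover have "Y' = Y" using calculation E' assms(3,5) unfolding bipartite33_def by blast
    ultimately show ?thesis using bipartite33_unique[of X Y E E'] assms E' by auto
  next
    case False
    have fin: "finite X" "finite X'" "card X = 3" "card X' = 3" "X \<inter> Y = {}" "X' \<inter> Y' = {}"
      using assms(3) E'(2) unfolding bipartite33_def by (auto intro: card_ge_0_finite)
    then have "card (X' - X) = 1" using False two
      by (metis Diff_eq_empty_iff card_0_eq finite_Diff le_less less_one)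
    then obtain b where b: "X' - X = {b}" by (auto simp: card_1_singleton_iff)
    have "card (X - X') = card (X' - X)"
      using fin by (simp add: card_Diff_subset_Int Int_commute)
    then obtain a where a: "X - X' = {a}" using b by (auto simp: card_1_singleton_iff)
    have "b \<in> Y" using b E' assms(5) by blast
    have "a \<in> X" using a by blast
    obtain E1 where E1: "reach E E1" "bipartite33 E1 (insert b (X - {a})) (insert a (Y - {b}))"
      using bipartite33_swap[OF assms(1,3) _ _ \<open>a \<in> X\<close> \<open>b \<in> Y\<close>] assms(5) by blast
    have X': "insert b (X - {a}) = X'" using a b by blast
    have Y': "insert a (Y - {b}) = Y'" using a b fin E' assms(5) by blast
    have "cubic_on V E1" using cubic_on_reach E1 assms(1) by blast
    then have "E1 = E'" using bipartite33_unique[of X' Y' E1 E'] E1(2) E' unfolding X' Y' by auto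
    then show ?thesis using E1 by simp
  qed
  have fin: "finite X'" "card X' = 3" "card Y = 3" "finite Y" "X' \<inter> Y' = {}" "X \<inter> Y = {}"
    using assms(3,4) unfolding bipartite33_def by (auto intro: card_ge_0_finite)
  show ?thesis
  proof (cases "card (X' - X) \<le> 1")
    case True
    then show ?thesis using near[OF assms(2,4,6)] by blast
  next
    case False
    \<comment> \<open>\<open>X'\<close> takes at least two of the three vertices of
      \<open>Y\<close>, so \<open>Y'\<close> contains at most one of them, and \<open>near\<close>
      applies with the parts of \<open>E'\<close> exchanged.\<close>
    have "X' - X = X' \<inter> Y" "Y' - X = Y - X'" using assms(5,6) fin by blast+
    moreover have "card (Y - X') = 3 - card (Y \<inter> X')"
      using fin card_Diff_subset_Int[of Y X'] by simp
    ultimately have "card (Y' - X) \<le> 1" using False by (simp add: Int_commute)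
    then show ?thesis using near[OF assms(2) bipartite33_sym[OF assms(4)]] assms(6) by blast
  qed
qed

lemma reach_cubic6:
  assumes E: "cubic_on V E" and E': "cubic_on V E'" and V: "card V = 6"
  shows "reach E E'"
proof -
  obtain F X Y where F: "reach E F" "bipartite33 F X Y" "X \<union> Y = V"
    using cubic6_reach_bipartite33[OF E V] by blast
  obtain F' X' Y' where F': "reach E' F'" "bipartite33 F' X' Y'" "X' \<union> Y' = V"
    using cubic6_reach_bipartite33[OF E' V] by blast
  have "reach F F'"
    by (rule reach_bipartite33[OF cubic_on_reach[OF F(1) E] cubic_on_reach[OF F'(1) E'] F(2) F'(2) F(3) F'(3)])
  then show ?thesis using F(1) reach_sym[OF F'(1) E'] by (meson rtranclp_trans)
qed

section \<open>Any two cubic graphs on the same vertices are connected by switches\<close>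

lemma reach_cubic:
  assumes "finite V" "cubic_on V E" "cubic_on V E'"
  shows "reach E E'"
  using assms
proof (induction "card V" arbitrary: V E E' rule: less_induct)
  case less
  consider "V = {}" | "card V = 6" | "V \<noteq> {}" "card V \<noteq> 6" by blast
  then show ?case
  proof cases
    case 1
    then have "E = E'" using cubic_subset_eq[OF less.prems(2,3)] cubic_edge[OF less.prems(2)] by blast
    then show ?thesis by simp
  next
    case 2
    then show ?thesis using reach_cubic6 less.prems by blast
  next
    case 3
    obtain F A where F: "reach E F" "clique4 F A"
      using K4able_if_card_ne_6[OF less.prems(2) 3] unfolding K4able_def by blast
    have cF: "cubic_on V F" using cubic_on_reach F less.prems by blast
    note sF = clique4_split[OF cF F(2)]
    have A: "finite A" "card A = 4" using F(2) unfolding clique4_def by (auto intro: card_ge_0_finite)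
    obtain F0 A0 where F0: "reach E' F0" "clique4 F0 A0"
      using K4able_if_card_ne_6[OF less.prems(3) 3] unfolding K4able_def by blast
    obtain F' where F': "reach F0 F'" "clique4 F' A"
      using clique4_move[OF cubic_on_reach[OF F0(1) less.prems(3)] F0(2) sF(1) A] by blast
    have r': "reach E' F'" using F0(1) F'(1) by (rule rtranclp_trans)
    have cF': "cubic_on V F'" using cubic_on_reach r' less.prems by blast
    note sF' = clique4_split[OF cF' F'(2)]
    have "card (V - A) < card V"
      using A card_Diff_subset[OF A(1) sF(1)] card_mono[OF less.prems(1) sF(1)] by simp
    \<comment> \<open>\<open>F\<close> and \<open>F'\<close> agree inside \<open>A\<close>, so it
      suffices to connect their remainders on the smaller set \<open>V - A\<close> and to add the
      common clique again.\<close>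
    then have "reach {e \<in> F. \<not> e \<subseteq> A} {e \<in> F'. \<not> e \<subseteq> A}"
      using less.hyps[OF _ _ sF(2) sF'(2)] less.prems(1) by blast
    then have "reach ({e \<in> F. \<not> e \<subseteq> A} \<union> {e. e \<subseteq> A \<and> card e = 2})
      ({e \<in> F'. \<not> e \<subseteq> A} \<union> {e. e \<subseteq> A \<and> card e = 2})"
      by (rule reach_union[OF _ sF(2)]) auto
    moreover have "{e \<in> F. \<not> e \<subseteq> A} \<union> {e. e \<subseteq> A \<and> card e = 2} = F"
      using sF(3) by blast
    moreover have "{e \<in> F'. \<not> e \<subseteq> A} \<union> {e. e \<subseteq> A \<and> card e = 2} = F'"
      using sF'(3) by blast
    ultimately have "reach F F'" by simp
    then show ?thesis using F(1) reach_sym[OF r' less.prems(3)] by (meson rtranclp_trans)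
  qed
qed

section \<open>From reachability to positive step probabilities\<close>

lemma step_prob_nonneg:
  assumes "\<And>x y. x \<in> S \<Longrightarrow> y \<in> S \<Longrightarrow> 0 \<le> P x y" "x \<in> S"
  shows "0 \<le> step_prob S P t x y"
  using assms(2) by (induction t arbitrary: x) (auto intro!: sum_nonneg mult_nonneg_nonneg assms(1))

lemma step_prob_Suc_pos:
  assumes "finite S" "\<And>x y. x \<in> S \<Longrightarrow> y \<in> S \<Longrightarrow> 0 \<le> P x y" "x \<in> S" "u \<in> S"
    "0 < P x u" "0 < step_prob S P t u y"
  shows "0 < step_prob S P (Suc t) x y"
proof -
  have "0 < P x u * step_prob S P t u y" using assms by simp
  then show ?thesis
    unfolding step_prob.simps
    by (intro sum_pos2[OF assms(1,4)]) (auto intro!: mult_nonneg_nonneg step_prob_nonneg assms(2,3))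
qed

text \<open>Along a switch sequence each step contributes a positive summand. The number of steps
  may be 0, namely when the sequence is empty.\<close>

lemma step_prob_pos_if_reach:
  assumes P: "triangle_switch_chain n P" and r: "reach E E'" and E: "E \<in> cubic_graphs n"
  shows "\<exists>t. 0 < step_prob (cubic_graphs n) P t E E'"
  using r E
proof (induction rule: converse_rtranclp_induct)
  case base
  then show ?case by (intro exI[of _ 0]) simp
next
  case (step E F)
  have F: "F \<in> cubic_graphs n" using cubic_on_switch step unfolding cubic_graphs_iff by blast
  then obtain t where "0 < step_prob (cubic_graphs n) P t F E'" using step by blast
  then show ?case
    using step_prob_Suc_pos[OF finite_cubic_graphs[of n] _ step.prems F] P step.hyps(1) step.prems F
    unfolding triangle_switch_chain_def transition_matrix_on_def by blast
qed

theorem theorem1: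
  fixes n :: nat and P :: "graph \<Rightarrow> graph \<Rightarrow> real"
  assumes "even n" and "n \<ge> 4"
    and "triangle_switch_chain n P"
  shows "irreducible_on (cubic_graphs n) P"
  unfolding irreducible_on_def
proof (intro ballI)
  let ?S = "cubic_graphs n"
  fix E E' assume E: "E \<in> ?S" and E': "E' \<in> ?S"
  have nonneg: "\<And>x y. x \<in> ?S \<Longrightarrow> y \<in> ?S \<Longrightarrow> 0 \<le> P x y" and "(\<Sum>y\<in>?S. P E y) = 1"
    using assms(3) E unfolding triangle_switch_chain_def transition_matrix_on_def by auto
  \<comment> \<open>An initial step from \<open>E\<close> to some \<open>F\<close> guarantees
    \<open>t \<ge> 1\<close> even when \<open>E = E'\<close>. Such an \<open>F\<close> exists
    because the row of \<open>E\<close> sums to 1, and any choice works since \<open>E'\<close> can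
    be reached from every cubic graph.\<close>
  then have "\<not> (\<forall>F\<in>?S. P E F \<le> 0)" using sum_nonpos[of ?S "P E"] by auto
  then obtain F where F: "F \<in> ?S" "0 < P E F" by (auto simp: not_le)
  have "reach F E'"
    using F(1) E' reach_cubic[of "{1..n}"] unfolding cubic_graphs_iff by blast
  then obtain t where "0 < step_prob ?S P t F E'"
    using step_prob_pos_if_reach[OF assms(3) _ F(1)] by blast
  then have "0 < step_prob ?S P (Suc t) E E'"
    using step_prob_Suc_pos[where S = ?S and P = P, OF finite_cubic_graphs nonneg E F] by blast
  then show "\<exists>t\<ge>1. 0 < step_prob ?S P t E E'" by (intro exI[of _ "Suc t"]) auto
qed

end
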